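(* In the equal mass case $\beta=9$, for every $0\le e<1$ the matrix $\gamma_{9,e}(2\pi)$ is hyperbolic and possesses a pair of positive double eigenvalues $\lambda(e)$ and $\lambda(e)^{-1}\ne1$. Consequently, for each $e\in[0,1)$, the matrix $\gamma_{\beta,e}(2\pi)$ is hyperbolic whenever $\beta<9$ is sufficiently close to $9$.
   Context: Let $J=\begin{pmatrix}0&-I_2\\ I_2&0\end{pmatrix}$ and $\mathrm{Sp}(4)=\{M\in \mathrm{GL}(4,\mathbb R): M^TJM=J\}$. For $(\beta,e)\in[0,9]\times[0,1)$ let $\gamma_{\beta,e}:[0,2\pi]\to\mathrm{Sp}(4)$ be the solution of $\dot\gamma(t)=JB(t)\gamma(t)$, $\gamma(0)=I_4$, where $$B(t)=\begin{pmatrix}1&0&0&1\\0&1&-1&0\\0&-1&\frac{2e\cos t-1-\sqrt{9-\beta}}{2(1+e\cos t)}&0\\1&0&0&\frac{2e\cos t-1+\sqrt{9-\beta}}{2(1+e\cos t)}\end{pmatrix}.$$ (It is the essential part of the fundamental solution of the linearized system along the elliptic Lagrangian solution of the planar three-body problem with eccentricity $e$ and mass parameter $\beta$.) A symplectic matrix is hyperbolic if it has no eigenvalue on the unit circle of $\mathbb C$. *)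

theory Defs
  imports Complex_Main "Jordan_Normal_Form.Char_Poly"
begin

text \<open>Rows and columns of a matrix are indexed from 0, so the four coordinates are 0, 1, 2, 3.\<close>

definition J4 :: "real mat" where
  "J4 = four_block_mat (0\<^sub>m 2 2) (- 1\<^sub>m 2) (1\<^sub>m 2) (0\<^sub>m 2 2)"

definition Sp4 :: "real mat set" where
  "Sp4 = {M \<in> carrier_mat 4 4. invertible_mat M \<and> transpose_mat M * J4 * M = J4}"

definition B_mat :: "real \<Rightarrow> real \<Rightarrow> real \<Rightarrow> real mat" where
  "B_mat \<beta> e t = mat_of_rows_list 4
     [[1, 0, 0, 1],
      [0, 1, -1, 0],
      [0, -1, (2 * e * cos t - 1 - sqrt (9 - \<beta>)) / (2 * (1 + e * cos t)), 0],
      [1, 0, 0, (2 * e * cos t - 1 + sqrt (9 - \<beta>)) / (2 * (1 + e * cos t))]]"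

text \<open>The derivative of a matrix-valued path is taken entrywise; at the end points of
  \<open>[0, 2\<pi>]\<close> it is one-sided. Values outside \<open>[0, 2\<pi>]\<close> are unconstrained. That the solution
  takes values in \<open>Sp4\<close> is a consequence of the equation and is not assumed.\<close>

definition fundamental_solution :: "real \<Rightarrow> real \<Rightarrow> (real \<Rightarrow> real mat) \<Rightarrow> bool" where
  "fundamental_solution \<beta> e g \<longleftrightarrow>
     (\<forall>t\<in>{0..2 * pi}. g t \<in> carrier_mat 4 4) \<and>
     g 0 = 1\<^sub>m 4 \<and>
     (\<forall>t\<in>{0..2 * pi}. \<forall>i<4. \<forall>j<4.
        ((\<lambda>s. g s $$ (i, j)) has_real_derivative (J4 * B_mat \<beta> e t * g t) $$ (i, j))
          (at t within {0..2 * pi}))"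

definition hyperbolic :: "real mat \<Rightarrow> bool" where
  "hyperbolic M \<longleftrightarrow> M \<in> Sp4 \<and>
     (\<forall>z. eigenvalue (map_mat complex_of_real M) z \<longrightarrow> cmod z \<noteq> 1)"

text \<open>Multiplicity is algebraic multiplicity. The qualified name avoids the order of a group.\<close>

definition double_eigenvalue :: "real mat \<Rightarrow> real \<Rightarrow> bool" where
  "double_eigenvalue M x \<longleftrightarrow> eigenvalue M x \<and> Polynomial.order x (char_poly M) = 2"

end

theory Submission
  imports Defs
begin

text \<open>Put \<open>u = 1 + e cos t\<close> and write \<open>(p, q)\<close> for a solution. The quadratic form
  \<open>Q = q \<bullet> p - (u'/u) |q|\<^sup>2\<close> satisfies
  \<open>Q' = |p - (u'/u) q|\<^sup>2 + ((1 + s) q\<^sub>1\<^sup>2 + (1 - s) q\<^sub>2\<^sup>2) / (2 u)\<close> with \<open>s = sqrt (9 - \<beta>)\<close>,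
  so for \<open>8 < \<beta> \<le> 9\<close> it strictly increases over a period. As \<open>Q\<close> has the same coefficients at
  \<open>0\<close> and \<open>2\<pi>\<close>, no eigenvalue can lie on the unit circle, which gives \<open>\<delta> = 1\<close> uniformly in \<open>e\<close>.

  For \<open>\<beta> = 9\<close> the rotation by the angle \<open>t\<close> splits the system into two copies of Hill's equation
  \<open>y'' = (3 / (2 u) - 1) y\<close>. As \<open>u'' = 1 - u\<close>, the function \<open>u\<close> is a strict supersolution, and
  \<open>v = y / u\<close>, \<open>w = u y' - u' y\<close> solve \<open>v' = w / u\<^sup>2\<close>, \<open>w' = u v / 2\<close>. The positive coefficients
  make both diagonal entries of the \<open>2 \<times> 2\<close> monodromy matrix exceed \<open>1\<close>.\<close>

section \<open>Monotonicity from one-sided derivatives\<close>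

lemma increasing_within_Icc:
  fixes f f' :: "real \<Rightarrow> real"
  assumes "a < b"
    and f: "\<And>x. x \<in> {a..b} \<Longrightarrow> (f has_real_derivative f' x) (at x within {a..b})"
    and pos: "\<And>x. a < x \<Longrightarrow> x < b \<Longrightarrow> f' x > 0"
  shows "f a < f b"
proof (rule DERIV_pos_imp_increasing_open[OF \<open>a < b\<close>])
  show "continuous_on {a..b} f"
    by (rule DERIV_continuous_on) (rule f)
  fix x assume x: "a < x" "x < b"
  with f[of x] have "(f has_real_derivative f' x) (at x)"
    by (simp add: at_within_Icc_at)
  with pos[OF x] show "\<exists>y. (f has_real_derivative y) (at x) \<and> y > 0" by blast
qed

lemma nondecreasing_within_Icc:
  fixes f f' :: "real \<Rightarrow> real"
  assumes f: "\<And>x. x \<in> {a..b} \<Longrightarrow> (f has_real_derivative f' x) (at x within {a..b})"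
    and nonneg: "\<And>x. x \<in> {a..b} \<Longrightarrow> f' x \<ge> 0"
    and xy: "a \<le> x" "x \<le> y" "y \<le> b"
  shows "f x \<le> f y"
proof (rule DERIV_nonneg_imp_increasing_open[OF \<open>x \<le> y\<close>])
  have "continuous_on {a..b} f"
    by (rule DERIV_continuous_on) (rule f)
  then show "continuous_on {x..y} f"
    by (rule continuous_on_subset) (use xy in auto)
  fix z assume z: "x < z" "z < y"
  with f[of z] xy have "(f has_real_derivative f' z) (at z)"
    by (simp add: at_within_Icc_at)
  then show "\<exists>d. (f has_real_derivative d) (at z) \<and> d \<ge> 0"
    using nonneg[of z] xy z by auto
qed

lemma constant_within_Icc:
  fixes f :: "real \<Rightarrow> real"
  assumes f: "\<And>x. x \<in> {a..b} \<Longrightarrow> (f has_real_derivative 0) (at x within {a..b})"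
    and x: "x \<in> {a..b}"
  shows "f x = f a"
proof (rule antisym)
  show "f a \<le> f x"
    by (rule nondecreasing_within_Icc[OF f]) (use x in auto)
  have "- f a \<le> - f x"
    by (rule nondecreasing_within_Icc[where f = "\<lambda>x. - f x" and f' = "\<lambda>_. 0" and a = a and b = b])
      (use x in \<open>auto intro!: derivative_eq_intros f\<close>)
  then show "f x \<le> f a" by simp
qed

text \<open>Positivity at the left end gives a strict gain just to its right, and monotonicity keeps
  it, so strictness can be read off from the initial data alone.\<close>

lemma less_within_Icc:
  fixes f f' :: "real \<Rightarrow> real"
  assumes "a < b"
    and f: "\<And>x. x \<in> {a..b} \<Longrightarrow> (f has_real_derivative f' x) (at x within {a..b})"
    and nonneg: "\<And>x. x \<in> {a..b} \<Longrightarrow> f' x \<ge> 0"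
    and pos: "f' a > 0"
  shows "f a < f b"
proof -
  obtain d where d: "d > 0" "\<And>h. h > 0 \<Longrightarrow> a + h \<in> {a..b} \<Longrightarrow> h < d \<Longrightarrow> f a < f (a + h)"
    using has_real_derivative_pos_inc_right[OF f pos] \<open>a < b\<close> by auto
  define h where "h = min (d / 2) (b - a)"
  have h: "h > 0" "h < d" "a + h \<le> b"
    using d(1) \<open>a < b\<close> by (auto simp: h_def min_def)
  have "f a < f (a + h)" by (rule d(2)) (use h in auto)
  also have "\<dots> \<le> f b"
    by (rule nondecreasing_within_Icc[OF f nonneg]) (use h in auto)
  finally show ?thesis .
qed

text \<open>The product \<open>f * g\<close> is nondecreasing from 0, so the square of
  \<open>f\<close> is nondecreasing and \<open>f\<close> cannot reach 0. Hence \<open>f\<close>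
  stays positive, which makes \<open>g\<close> positive after \<open>a\<close>, and then
  \<open>f\<close> strictly increases.\<close>

lemma cooperative_growth:
  fixes f g \<phi> \<psi> :: "real \<Rightarrow> real"
  assumes "a < b"
    and f: "\<And>x. x \<in> {a..b} \<Longrightarrow> (f has_real_derivative \<phi> x * g x) (at x within {a..b})"
    and g: "\<And>x. x \<in> {a..b} \<Longrightarrow> (g has_real_derivative \<psi> x * f x) (at x within {a..b})"
    and pos: "\<And>x. x \<in> {a..b} \<Longrightarrow> \<phi> x > 0" "\<And>x. x \<in> {a..b} \<Longrightarrow> \<psi> x > 0"
    and init: "f a > 0" "g a = 0"
  shows "f a < f b"
proof -
  have fg: "f x * g x \<ge> 0" if x: "x \<in> {a..b}" for x
  proof -
    have "f a * g a \<le> f x * g x"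
    proof (rule nondecreasing_within_Icc[where f = "\<lambda>x. f x * g x" and a = a and b = b
          and f' = "\<lambda>x. \<phi> x * (g x)\<^sup>2 + \<psi> x * (f x)\<^sup>2"])
      fix y assume y: "y \<in> {a..b}"
      show "((\<lambda>x. f x * g x) has_real_derivative \<phi> y * (g y)\<^sup>2 + \<psi> y * (f y)\<^sup>2)
          (at y within {a..b})"
        using y by (auto intro!: derivative_eq_intros f g simp: power2_eq_square)
      show "\<phi> y * (g y)\<^sup>2 + \<psi> y * (f y)\<^sup>2 \<ge> 0"
        using pos[OF y] by simp
    qed (use x in auto)
    with init show ?thesis by simp
  qed
  have f_nz: "f x \<noteq> 0" if x: "x \<in> {a..b}" for x
  proof -
    have "(f a)\<^sup>2 \<le> (f x)\<^sup>2"
    proof (rule nondecreasing_within_Icc[where f = "\<lambda>x. (f x)\<^sup>2" and a = a and b = b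
          and f' = "\<lambda>x. 2 * \<phi> x * (f x * g x)"])
      fix y assume y: "y \<in> {a..b}"
      show "((\<lambda>x. (f x)\<^sup>2) has_real_derivative 2 * \<phi> y * (f y * g y)) (at y within {a..b})"
        using y by (auto intro!: derivative_eq_intros f)
      show "2 * \<phi> y * (f y * g y) \<ge> 0"
        using pos(1)[OF y] fg[OF y] by simp
    qed (use x in auto)
    with init show ?thesis by auto
  qed
  have cont: "continuous_on {a..b} f"
    by (rule DERIV_continuous_on) (rule f)
  have f_pos: "f x > 0" if x: "x \<in> {a..b}" for x
  proof (rule ccontr)
    assume "\<not> f x > 0"
    then have "\<exists>z. a \<le> z \<and> z \<le> x \<and> f z = 0"
      by (intro IVT2') (use x init cont in \<open>auto intro: continuous_on_subset\<close>)
    with f_nz x show False by auto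
  qed
  have g_pos: "g x > 0" if x: "a < x" "x \<le> b" for x
  proof -
    have "g a < g x"
      by (rule increasing_within_Icc[where f' = "\<lambda>x. \<psi> x * f x"])
        (use x pos f_pos in \<open>auto intro: has_field_derivative_subset[OF g]\<close>)
    with init show ?thesis by simp
  qed
  show ?thesis
    by (rule increasing_within_Icc[OF \<open>a < b\<close> f]) (use pos g_pos in auto)
qed

section \<open>Solutions in coordinates\<close>

lemma kepler_denom_pos:
  fixes e :: real
  assumes "e \<in> {0..<1}"
  shows "1 + e * cos t > 0"
proof -
  have "- e \<le> e * cos t"
    using mult_left_mono[of "- 1" "cos t" e] assms by auto
  with assms show ?thesis by auto
qed

text \<open>The choices \<open>\<sigma> = - sqrt (9 - \<beta>)\<close> and
  \<open>\<sigma> = sqrt (9 - \<beta>)\<close> give the last two diagonal entries of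
  \<open>B_mat \<beta> e t\<close>; equal masses correspond to \<open>\<sigma> = 0\<close>.\<close>

definition kepler_coeff where
  "kepler_coeff e \<sigma> t = (2 * e * cos t - 1 + \<sigma>) / (2 * (1 + e * cos t))" for e \<sigma> t :: real

text \<open>The components \<open>x 0\<close>, \<open>x 1\<close> are \<open>p\<close> and \<open>x 2\<close>, \<open>x 3\<close> are \<open>q\<close>. The coefficients \<open>k\<close>, \<open>l\<close> are
  the last two diagonal entries of the coefficient matrix.\<close>

definition solves :: "(real \<Rightarrow> real) \<Rightarrow> (real \<Rightarrow> real) \<Rightarrow> (nat \<Rightarrow> real \<Rightarrow> real) \<Rightarrow> bool" where
  "solves k l x \<longleftrightarrow> (\<forall>t\<in>{0..2 * pi}.
     (x 0 has_real_derivative x 1 t - k t * x 2 t) (at t within {0..2 * pi}) \<and>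
     (x 1 has_real_derivative - x 0 t - l t * x 3 t) (at t within {0..2 * pi}) \<and>
     (x 2 has_real_derivative x 0 t + x 3 t) (at t within {0..2 * pi}) \<and>
     (x 3 has_real_derivative x 1 t - x 2 t) (at t within {0..2 * pi}))"

lemma solvesD:
  assumes "solves k l x" "t \<in> {0..2 * pi}"
  shows "(x 0 has_real_derivative x 1 t - k t * x 2 t) (at t within {0..2 * pi})"
    "(x 1 has_real_derivative - x 0 t - l t * x 3 t) (at t within {0..2 * pi})"
    "(x 2 has_real_derivative x 0 t + x 3 t) (at t within {0..2 * pi})"
    "(x 3 has_real_derivative x 1 t - x 2 t) (at t within {0..2 * pi})"
  using assms by (auto simp: solves_def)

section \<open>From the matrix equation to scalar equations\<close>

lemmas less_4_cases = less_Suc_eq numeral_eq_Suc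

lemma sum_upto_4: "(\<Sum>k = 0..<4. f k) = f 0 + f 1 + f 2 + f (3 :: nat)"
  for f :: "nat \<Rightarrow> 'a :: comm_monoid_add"
  by (simp add: numeral_eq_Suc ac_simps)

lemma index_mult_mat_sum:
  assumes "A \<in> carrier_mat n m" "B \<in> carrier_mat m k" "i < n" "j < k"
  shows "(A * B) $$ (i, j) = (\<Sum>l = 0..<m. A $$ (i, l) * B $$ (l, j))"
  using assms by (auto simp: scalar_prod_def)

lemma J4_index:
  assumes "i < 4" "j < 4"
  shows "J4 $$ (i, j) = (if j = i + 2 then - 1 else if i = j + 2 then 1 else 0)"
  using assms by (auto simp: J4_def less_4_cases)

lemma J4_carrier: "J4 \<in> carrier_mat 4 4"
  by (auto simp: J4_def)

lemma B_mat_carrier: "B_mat \<beta> e t \<in> carrier_mat 4 4"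
  by (auto simp: B_mat_def mat_of_rows_list_def)

lemma J4_B_mat_mult_index:
  assumes A: "A \<in> carrier_mat 4 4" and j: "j < 4"
  shows "(J4 * B_mat \<beta> e t * A) $$ (0, j) =
      A $$ (1, j) - kepler_coeff e (- sqrt (9 - \<beta>)) t * A $$ (2, j)"
    and "(J4 * B_mat \<beta> e t * A) $$ (1, j) =
      - A $$ (0, j) - kepler_coeff e (sqrt (9 - \<beta>)) t * A $$ (3, j)"
    and "(J4 * B_mat \<beta> e t * A) $$ (2, j) = A $$ (0, j) + A $$ (3, j)"
    and "(J4 * B_mat \<beta> e t * A) $$ (3, j) = A $$ (1, j) - A $$ (2, j)"
proof -
  have JB: "(J4 * B_mat \<beta> e t) $$ (i, k) = (\<Sum>l = 0..<4. J4 $$ (i, l) * B_mat \<beta> e t $$ (l, k))"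
    if "i < 4" "k < 4" for i k
    using index_mult_mat_sum[OF J4_carrier B_mat_carrier] that by blast
  have JBA: "(J4 * B_mat \<beta> e t * A) $$ (i, j) =
      (\<Sum>k = 0..<4. (J4 * B_mat \<beta> e t) $$ (i, k) * A $$ (k, j))"
    if "i < 4" for i
    using index_mult_mat_sum[OF mult_carrier_mat[OF J4_carrier B_mat_carrier] A] that j by blast
  have B: "B_mat \<beta> e t $$ (i, k) =
     [[1, 0, 0, 1],
      [0, 1, -1, 0],
      [0, -1, kepler_coeff e (- sqrt (9 - \<beta>)) t, 0],
      [1, 0, 0, kepler_coeff e (sqrt (9 - \<beta>)) t]] ! i ! k"
    if "i < 4" "k < 4" for i k
    using that by (simp add: B_mat_def mat_of_rows_list_def kepler_coeff_def)
  note simps = JBA JB B J4_index sum_upto_4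
  show "(J4 * B_mat \<beta> e t * A) $$ (0, j) =
      A $$ (1, j) - kepler_coeff e (- sqrt (9 - \<beta>)) t * A $$ (2, j)"
    by (simp add: simps)
  show "(J4 * B_mat \<beta> e t * A) $$ (1, j) =
      - A $$ (0, j) - kepler_coeff e (sqrt (9 - \<beta>)) t * A $$ (3, j)"
    by (simp add: simps)
  show "(J4 * B_mat \<beta> e t * A) $$ (2, j) = A $$ (0, j) + A $$ (3, j)"
    by (simp add: simps)
  show "(J4 * B_mat \<beta> e t * A) $$ (3, j) = A $$ (1, j) - A $$ (2, j)"
    by (simp add: simps)
qed

lemma solves_column:
  assumes g: "fundamental_solution \<beta> e g" and j: "j < 4"
  shows "solves (kepler_coeff e (- sqrt (9 - \<beta>))) (kepler_coeff e (sqrt (9 - \<beta>))) (\<lambda>i t. g t $$ (i, j))"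
  unfolding solves_def
proof
  fix t assume t: "t \<in> {0..2 * pi}"
  then have A: "g t \<in> carrier_mat 4 4"
    using g by (auto simp: fundamental_solution_def)
  have D: "((\<lambda>s. g s $$ (i, j)) has_real_derivative (J4 * B_mat \<beta> e t * g t) $$ (i, j))
          (at t within {0..2 * pi})" if "i < 4" for i
    using g j t that by (auto simp: fundamental_solution_def)
  show "((\<lambda>s. g s $$ (0, j)) has_real_derivative g t $$ (1, j) -
      kepler_coeff e (- sqrt (9 - \<beta>)) t * g t $$ (2, j))
      (at t within {0..2 * pi}) \<and>
    ((\<lambda>s. g s $$ (1, j)) has_real_derivative - g t $$ (0, j) -
      kepler_coeff e (sqrt (9 - \<beta>)) t * g t $$ (3, j))
      (at t within {0..2 * pi}) \<and>
    ((\<lambda>s. g s $$ (2, j)) has_real_derivative g t $$ (0, j) + g t $$ (3, j))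
      (at t within {0..2 * pi}) \<and>
    ((\<lambda>s. g s $$ (3, j)) has_real_derivative g t $$ (1, j) - g t $$ (2, j))
      (at t within {0..2 * pi})"
    using D[of 0] D[of 1] D[of 2] D[of 3] unfolding J4_B_mat_mult_index[OF A j] by simp
qed

text \<open>Linearity of the system, meant for columns weighted by the real or imaginary parts of a
  complex eigenvector.\<close>

lemma solves_sum:
  assumes "\<And>j. j \<in> S \<Longrightarrow> solves k l (x j)"
  shows "solves k l (\<lambda>i t. \<Sum>j\<in>S. c j * x j i t)"
proof -
  have D: "((\<lambda>t. \<Sum>j\<in>S. c j * x j i t) has_real_derivative E) (at t within {0..2 * pi})"
    if "\<And>j. j \<in> S \<Longrightarrow> (x j i has_real_derivative D j) (at t within {0..2 * pi})"
      and "(\<Sum>j\<in>S. c j * D j) = E" for i t D E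
  proof -
    have "((\<lambda>t. \<Sum>j\<in>S. c j * x j i t) has_real_derivative (\<Sum>j\<in>S. c j * D j))
        (at t within {0..2 * pi})"
      by (intro DERIV_sum DERIV_cmult that(1))
    with that(2) show ?thesis by simp
  qed
  show ?thesis
    unfolding solves_def
    by (intro ballI conjI; rule D, erule (1) solvesD[OF assms])
      (simp_all add: sum_subtractf sum.distrib sum_negf sum_distrib_left algebra_simps)
qed

text \<open>This is the bilinear form of \<open>J4\<close> on two solutions; its derivative cancels
  because the system is Hamiltonian.\<close>

lemma symplectic_form_constant:
  assumes x: "solves k l x" and y: "solves k l y" and t: "t \<in> {0..2 * pi}"
  shows "x 2 t * y 0 t + x 3 t * y 1 t - x 0 t * y 2 t - x 1 t * y 3 t =
         x 2 0 * y 0 0 + x 3 0 * y 1 0 - x 0 0 * y 2 0 - x 1 0 * y 3 0"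
proof (rule constant_within_Icc[OF _ t, where
        f = "\<lambda>t. x 2 t * y 0 t + x 3 t * y 1 t - x 0 t * y 2 t - x 1 t * y 3 t"])
  fix t assume t: "t \<in> {0..2 * pi}"
  show "((\<lambda>t. x 2 t * y 0 t + x 3 t * y 1 t - x 0 t * y 2 t - x 1 t * y 3 t)
      has_real_derivative 0) (at t within {0..2 * pi})"
    by (rule derivative_eq_intros solvesD[OF x t] solvesD[OF y t] refl)+ (simp add: algebra_simps)
qed

section \<open>Symplecticity\<close>

text \<open>The entries of \<open>transpose_mat (g t) * J4 * g t\<close> are the conserved form on
  pairs of columns, so they keep their values at time 0, where \<open>g\<close> is the
  identity.\<close>

lemma fundamental_solution_symplectic:
  assumes g: "fundamental_solution \<beta> e g" and t: "t \<in> {0..2 * pi}"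
  shows "g t \<in> Sp4"
proof -
  have A: "g t \<in> carrier_mat 4 4" and g0: "g 0 = 1\<^sub>m 4"
    using g t by (auto simp: fundamental_solution_def)
  have T: "transpose_mat (g t) \<in> carrier_mat 4 4" using A by simp
  have sympl: "transpose_mat (g t) * J4 * g t = J4"
  proof (rule eq_matI)
    fix i j assume "i < dim_row J4" "j < dim_col J4"
    then have ij: "i < 4" "j < 4" using J4_carrier by auto
    have TJ: "(transpose_mat (g t) * J4) $$ (i, k) =
        (\<Sum>l = 0..<4. transpose_mat (g t) $$ (i, l) * J4 $$ (l, k))" if "k < 4" for k
      using index_mult_mat_sum[OF T J4_carrier] ij that by blast
    have "(transpose_mat (g t) * J4 * g t) $$ (i, j) =
        (\<Sum>k = 0..<4. (transpose_mat (g t) * J4) $$ (i, k) * g t $$ (k, j))"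
      using index_mult_mat_sum[OF mult_carrier_mat[OF T J4_carrier] A] ij by blast
    also have "\<dots> = g t $$ (2, i) * g t $$ (0, j) + g t $$ (3, i) * g t $$ (1, j)
        - g t $$ (0, i) * g t $$ (2, j) - g t $$ (1, i) * g t $$ (3, j)"
      using A ij by (simp add: TJ sum_upto_4 J4_index)
    also have "\<dots> = g 0 $$ (2, i) * g 0 $$ (0, j) + g 0 $$ (3, i) * g 0 $$ (1, j)
        - g 0 $$ (0, i) * g 0 $$ (2, j) - g 0 $$ (1, i) * g 0 $$ (3, j)"
      using symplectic_form_constant[OF solves_column[OF g ij(1)] solves_column[OF g ij(2)] t] .
    also have "\<dots> = J4 $$ (i, j)"
      unfolding g0 J4_index[OF ij] using ij by (auto simp: less_4_cases)
    finally show "(transpose_mat (g t) * J4 * g t) $$ (i, j) = J4 $$ (i, j)" .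
  qed (use A J4_carrier in auto)
  have JJ: "- (J4 * J4) = 1\<^sub>m 4"
  proof (rule eq_matI)
    fix i j assume "i < dim_row (1\<^sub>m 4 :: real mat)" "j < dim_col (1\<^sub>m 4 :: real mat)"
    then have ij: "i < 4" "j < 4" by auto
    then have "(- (J4 * J4)) $$ (i, j) = - ((J4 * J4) $$ (i, j))"
      using J4_carrier by auto
    also have "\<dots> = - (\<Sum>k = 0..<4. J4 $$ (i, k) * J4 $$ (k, j))"
      by (simp only: index_mult_mat_sum[OF J4_carrier J4_carrier ij])
    also have "\<dots> = (1\<^sub>m 4 :: real mat) $$ (i, j)"
      using ij by (auto simp: sum_upto_4 J4_index less_4_cases)
    finally show "(- (J4 * J4)) $$ (i, j) = (1\<^sub>m 4 :: real mat) $$ (i, j)" .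
  qed (use J4_carrier in auto)
  \<comment> \<open>As \<open>J4\<close> squares to minus the identity, symplecticity makes this a
    left inverse of \<open>g t\<close>.\<close>
  define L where "L = - (J4 * (transpose_mat (g t) * J4))"
  have L: "L \<in> carrier_mat 4 4" using T J4_carrier by (simp add: L_def)
  have LA: "L * g t = 1\<^sub>m 4"
  proof -
    have "L * g t = - (J4 * (transpose_mat (g t) * J4) * g t)"
      unfolding L_def using A T J4_carrier by (intro uminus_mult_left_mat) auto
    also have "J4 * (transpose_mat (g t) * J4) * g t = J4 * (transpose_mat (g t) * J4 * g t)"
      by (rule assoc_mult_mat[OF J4_carrier mult_carrier_mat[OF T J4_carrier] A])
    finally show ?thesis by (simp add: sympl JJ)
  qed
  have "invertible_mat (g t)"
    using A L LA mat_mult_left_right_inverse[OF L A LA]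
    by (auto simp: invertible_mat_def inverts_mat_def square_mat.simps)
  with A sympl show ?thesis by (simp add: Sp4_def)
qed


section \<open>The quadratic form and hyperbolicity\<close>

text \<open>The rotation terms of the system cancel in the derivative of q . p. The coefficient
  \<open>R = - u' / u\<close> satisfies the Riccati equation \<open>R' = 1 - 1 / u + R^2\<close>,
  and its term \<open>R^2\<close> completes the squares.\<close>

lemma quadratic_form_derivative:
  assumes e: "e \<in> {0..<1}" and t: "t \<in> {0..2 * pi}"
    and x: "solves (kepler_coeff e (- \<sigma>)) (kepler_coeff e \<sigma>) x"
  shows "((\<lambda>t. x 2 t * x 0 t + x 3 t * x 1 t
        + e * sin t / (1 + e * cos t) * ((x 2 t)\<^sup>2 + (x 3 t)\<^sup>2)) has_real_derivative
      (x 0 t + e * sin t / (1 + e * cos t) * x 2 t)\<^sup>2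
      + (x 1 t + e * sin t / (1 + e * cos t) * x 3 t)\<^sup>2
      + ((1 + \<sigma>) * (x 2 t)\<^sup>2 + (1 - \<sigma>) * (x 3 t)\<^sup>2) / (2 * (1 + e * cos t)))
    (at t within {0..2 * pi})"
proof -
  define u where "u = 1 + e * cos t"
  define w where "w = 1 / u"
  define R where "R = (\<lambda>t. e * sin t / (1 + e * cos t))"
  have u: "u > 0" using kepler_denom_pos[OF e] by (simp add: u_def)
  have ecos: "e * cos t = u - 1" by (simp add: u_def)
  have k: "kepler_coeff e s t = 1 + (s - 3) * w / 2" for s
    using u unfolding kepler_coeff_def w_def mult.assoc ecos by (simp add: field_simps)
  have R: "(R has_real_derivative 1 - w + (R t)\<^sup>2) (at t within {0..2 * pi})"
  proof -
    have "(R has_real_derivative (e * cos t * u - e * sin t * (- (e * sin t))) / (u * u))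
        (at t within {0..2 * pi})"
      unfolding R_def u_def using u
      by (auto intro!: derivative_eq_intros simp: u_def)
    also have "(e * cos t * u - e * sin t * (- (e * sin t))) / (u * u) = 1 - w + (R t)\<^sup>2"
      using u unfolding w_def R_def ecos u_def[symmetric]
      by (simp add: field_simps power2_eq_square)
    finally show ?thesis .
  qed
  have "((\<lambda>t. x 2 t * x 0 t + x 3 t * x 1 t + R t * ((x 2 t)\<^sup>2 + (x 3 t)\<^sup>2)) has_real_derivative
      (x 0 t + R t * x 2 t)\<^sup>2 + (x 1 t + R t * x 3 t)\<^sup>2
      + ((1 + \<sigma>) * (x 2 t)\<^sup>2 + (1 - \<sigma>) * (x 3 t)\<^sup>2) * w / 2)
    (at t within {0..2 * pi})"
    by (rule derivative_eq_intros solvesD[OF x t] R refl)+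
      (simp add: k power2_eq_square field_simps)
  then show ?thesis
    by (simp add: R_def w_def u_def mult.commute)
qed

text \<open>Since \<open>sin\<close> vanishes at both ends, the corrected form reduces to q . p
  there. The bounds on \<open>\<sigma>\<close> make its derivative a positive definite form in the
  solution.\<close>

lemma quadratic_form_increases:
  assumes e: "e \<in> {0..<1}" and \<sigma>: "0 \<le> \<sigma>" "\<sigma> < 1"
    and x: "solves (kepler_coeff e (- \<sigma>)) (kepler_coeff e \<sigma>) x"
  shows "x 2 0 * x 0 0 + x 3 0 * x 1 0
      \<le> x 2 (2 * pi) * x 0 (2 * pi) + x 3 (2 * pi) * x 1 (2 * pi)" (is "?l \<le> ?r")
    and "(\<exists>i<4. x i 0 \<noteq> 0) \<Longrightarrow> x 2 0 * x 0 0 + x 3 0 * x 1 0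
      < x 2 (2 * pi) * x 0 (2 * pi) + x 3 (2 * pi) * x 1 (2 * pi)"
proof -
  define Q where "Q = (\<lambda>t. x 2 t * x 0 t + x 3 t * x 1 t
        + e * sin t / (1 + e * cos t) * ((x 2 t)\<^sup>2 + (x 3 t)\<^sup>2))"
  define Q' where "Q' = (\<lambda>t. (x 0 t + e * sin t / (1 + e * cos t) * x 2 t)\<^sup>2
      + (x 1 t + e * sin t / (1 + e * cos t) * x 3 t)\<^sup>2
      + ((1 + \<sigma>) * (x 2 t)\<^sup>2 + (1 - \<sigma>) * (x 3 t)\<^sup>2) / (2 * (1 + e * cos t)))"
  have ends: "Q 0 = ?l" "Q (2 * pi) = ?r"
    by (simp_all add: Q_def)
  have Q: "(Q has_real_derivative Q' t) (at t within {0..2 * pi})" if "t \<in> {0..2 * pi}" for t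
    unfolding Q_def Q'_def using quadratic_form_derivative[OF e that x] .
  have nonneg: "Q' t \<ge> 0" for t
    using \<sigma> kepler_denom_pos[OF e, of t] by (simp add: Q'_def)
  show "?l \<le> ?r"
    unfolding ends[symmetric]
    by (rule nondecreasing_within_Icc[where a = 0 and b = "2 * pi", OF Q nonneg]) auto
  assume "\<exists>i<4. x i 0 \<noteq> 0"
  then have nz: "x 0 0 \<noteq> 0 \<or> x 1 0 \<noteq> 0 \<or> x 2 0 \<noteq> 0 \<or> x 3 0 \<noteq> 0"
    by (auto simp: less_4_cases)
  \<comment> \<open>At time 0 the correction vanishes, and \<open>Q' 0\<close> is a sum of squares
    of the four initial values with positive weights.\<close>
  have "Q' 0 \<noteq> 0"
  proof
    assume "Q' 0 = 0"
    then have "(x 0 0)\<^sup>2 + (x 1 0)\<^sup>2 + (1 + \<sigma>) * (x 2 0)\<^sup>2 / (2 * (1 + e))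
        + (1 - \<sigma>) * (x 3 0)\<^sup>2 / (2 * (1 + e)) = 0"
      by (simp add: Q'_def add_divide_distrib)
    moreover have "(x 0 0)\<^sup>2 \<ge> 0" "(x 1 0)\<^sup>2 \<ge> 0" "(1 + \<sigma>) * (x 2 0)\<^sup>2 / (2 * (1 + e)) \<ge> 0"
        "(1 - \<sigma>) * (x 3 0)\<^sup>2 / (2 * (1 + e)) \<ge> 0"
      using e \<sigma> by auto
    ultimately have "(x 0 0)\<^sup>2 = 0" "(x 1 0)\<^sup>2 = 0" "(1 + \<sigma>) * (x 2 0)\<^sup>2 / (2 * (1 + e)) = 0"
        "(1 - \<sigma>) * (x 3 0)\<^sup>2 / (2 * (1 + e)) = 0"
      by linarith+
    with nz e \<sigma> show False by auto
  qed
  with nonneg[of 0] have "Q' 0 > 0" by simp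
  then show "?l < ?r"
    unfolding ends[symmetric] by (intro less_within_Icc[OF _ Q nonneg]) auto
qed

text \<open>Multiplication by a unit complex number is a rotation of the plane and preserves the
  real inner product.\<close>

lemma Re_Im_rotate:
  assumes "cmod z = 1"
  shows "Re (z * v) * Re (z * w) + Im (z * v) * Im (z * w) = Re v * Re w + Im v * Im w"
proof -
  have "Re (z * v) * Re (z * w) + Im (z * v) * Im (z * w)
      = ((Re z)\<^sup>2 + (Im z)\<^sup>2) * (Re v * Re w + Im v * Im w)"
    by (simp add: algebra_simps power2_eq_square)
  with assms show ?thesis
    by (simp add: cmod_power2[symmetric])
qed

text \<open>The real and imaginary parts of an eigenvector generate two real solutions. If the
  eigenvalue had modulus 1, the sum of q . p over both would return to its initial value after a
  period, yet monotonicity makes it strictly larger.\<close>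

lemma eigenvalue_off_unit_circle:
  assumes e: "e \<in> {0..<1}" and \<beta>: "8 < \<beta>" "\<beta> \<le> 9"
    and g: "fundamental_solution \<beta> e g"
    and z: "eigenvalue (map_mat complex_of_real (g (2 * pi))) z"
  shows "cmod z \<noteq> 1"
proof
  assume unit: "cmod z = 1"
  let ?M = "map_mat complex_of_real (g (2 * pi))"
  have M: "g (2 * pi) \<in> carrier_mat 4 4" and g0: "g 0 = 1\<^sub>m 4"
    using g by (auto simp: fundamental_solution_def)
  from z obtain v where v: "v \<in> carrier_vec 4" "v \<noteq> 0\<^sub>v 4" "?M *\<^sub>v v = z \<cdot>\<^sub>v v"
    using M by (auto simp: eigenvalue_def eigenvector_def)
  have Mv: "(\<Sum>j = 0..<4. complex_of_real (g (2 * pi) $$ (i, j)) * v $ j) = z * v $ i"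
    if i: "i < 4" for i
  proof -
    have "(?M *\<^sub>v v) $ i = (z \<cdot>\<^sub>v v) $ i" using v(3) by simp
    with i M v(1) show ?thesis by (auto simp: scalar_prod_def)
  qed
  define x where "x = (\<lambda>i t. \<Sum>j = 0..<4. Re (v $ j) * g t $$ (i, j))"
  define y where "y = (\<lambda>i t. \<Sum>j = 0..<4. Im (v $ j) * g t $$ (i, j))"
  define \<sigma> where "\<sigma> = sqrt (9 - \<beta>)"
  \<comment> \<open>The threshold \<open>8 < \<beta>\<close> is exactly the condition
    \<open>\<sigma> < 1\<close>.\<close>
  have \<sigma>: "0 \<le> \<sigma>" "\<sigma> < 1" using \<beta> by (auto simp: \<sigma>_def)
  have sx: "solves (kepler_coeff e (- \<sigma>)) (kepler_coeff e \<sigma>) x"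
    and sy: "solves (kepler_coeff e (- \<sigma>)) (kepler_coeff e \<sigma>) y"
    unfolding x_def y_def \<sigma>_def by (rule solves_sum, rule solves_column[OF g], simp)+
  have init: "x i 0 = Re (v $ i)" "y i 0 = Im (v $ i)" if "i < 4" for i
    using that by (auto simp: x_def y_def g0 sum_upto_4 less_4_cases)
  have final: "x i (2 * pi) = Re (z * v $ i)" "y i (2 * pi) = Im (z * v $ i)" if "i < 4" for i
    unfolding Mv[OF that, symmetric] by (simp_all add: x_def y_def mult.commute)
  have "\<exists>i<4. v $ i \<noteq> 0"
    using v(1,2) by (metis carrier_vecD eq_vecI index_zero_vec(1,2))
  then have "(\<exists>i<4. x i 0 \<noteq> 0) \<or> (\<exists>i<4. y i 0 \<noteq> 0)"
    by (metis init complex_eqI zero_complex.sel)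
  then have "x 2 0 * x 0 0 + x 3 0 * x 1 0 + (y 2 0 * y 0 0 + y 3 0 * y 1 0)
      < x 2 (2 * pi) * x 0 (2 * pi) + x 3 (2 * pi) * x 1 (2 * pi)
        + (y 2 (2 * pi) * y 0 (2 * pi) + y 3 (2 * pi) * y 1 (2 * pi))"
    using quadratic_form_increases[OF e \<sigma> sx] quadratic_form_increases[OF e \<sigma> sy]
    by (auto intro: add_less_le_mono add_le_less_mono)
  moreover have "x 2 (2 * pi) * x 0 (2 * pi) + y 2 (2 * pi) * y 0 (2 * pi)
      = x 2 0 * x 0 0 + y 2 0 * y 0 0"
    using Re_Im_rotate[OF unit, of "v $ 2" "v $ 0"] init final by simp
  moreover have "x 3 (2 * pi) * x 1 (2 * pi) + y 3 (2 * pi) * y 1 (2 * pi)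
      = x 3 0 * x 1 0 + y 3 0 * y 1 0"
    using Re_Im_rotate[OF unit, of "v $ 3" "v $ 1"] init[of 3] init[of 1] final[of 3] final[of 1]
    by simp
  ultimately show False by linarith
qed

lemma hyperbolic_near_equal_mass:
  assumes "e \<in> {0..<1}" "8 < \<beta>" "\<beta> \<le> 9" "fundamental_solution \<beta> e g"
  shows "hyperbolic (g (2 * pi))"
  using eigenvalue_off_unit_circle[OF assms] fundamental_solution_symplectic[OF assms(4)]
  by (auto simp: hyperbolic_def)

section \<open>Reduction to Hill's equation for equal masses\<close>

definition hill :: "real \<Rightarrow> (real \<Rightarrow> real) \<Rightarrow> (real \<Rightarrow> real) \<Rightarrow> bool" where
  "hill e y p \<longleftrightarrow> (\<forall>t\<in>{0..2 * pi}.
     (y has_real_derivative p t) (at t within {0..2 * pi}) \<and>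
     (p has_real_derivative - kepler_coeff e 0 t * y t) (at t within {0..2 * pi}))"

lemma hillD:
  assumes "hill e y p" "t \<in> {0..2 * pi}"
  shows "(y has_real_derivative p t) (at t within {0..2 * pi})"
    "(p has_real_derivative - kepler_coeff e 0 t * y t) (at t within {0..2 * pi})"
  using assms by (auto simp: hill_def)

text \<open>The Wronskian is constant because the second-order equation has no first-order
  term.\<close>

lemma hill_wronskian:
  assumes y: "hill e y p" and z: "hill e z q" and t: "t \<in> {0..2 * pi}"
  shows "y t * q t - p t * z t = y 0 * q 0 - p 0 * z 0"
proof (rule constant_within_Icc[OF _ t, where f = "\<lambda>t. y t * q t - p t * z t"])
  fix t assume t: "t \<in> {0..2 * pi}"
  show "((\<lambda>t. y t * q t - p t * z t) has_real_derivative 0) (at t within {0..2 * pi})"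
    by (rule derivative_eq_intros hillD[OF y t] hillD[OF z t] refl)+ (simp add: algebra_simps)
qed

text \<open>Cramer's rule: the Wronskians of \<open>y\<close> with the basic solutions recover its
  initial data, and that of the basic solutions with each other is the determinant 1.\<close>

lemma hill_combination:
  assumes y: "hill e y p"
    and y1: "hill e y1 p1" "y1 0 = 1" "p1 0 = 0"
    and y2: "hill e y2 p2" "y2 0 = 0" "p2 0 = 1"
    and t: "t \<in> {0..2 * pi}"
  shows "y t = y 0 * y1 t + p 0 * y2 t" "p t = y 0 * p1 t + p 0 * p2 t"
proof -
  have w1: "p 0 = y1 t * p t - p1 t * y t"
    using hill_wronskian[OF y1(1) y t] y1 by simp
  have w2: "y 0 = p2 t * y t - y2 t * p t"
    using hill_wronskian[OF y2(1) y t] y2 by simp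
  have w: "y1 t * p2 t - p1 t * y2 t = 1"
    using hill_wronskian[OF y1(1) y2(1) t] y1 y2 by simp
  have "y 0 * y1 t + p 0 * y2 t = y t * (y1 t * p2 t - p1 t * y2 t)"
    unfolding w1 w2 by (simp add: algebra_simps)
  with w show "y t = y 0 * y1 t + p 0 * y2 t" by simp
  have "y 0 * p1 t + p 0 * p2 t = p t * (y1 t * p2 t - p1 t * y2 t)"
    unfolding w1 w2 by (simp add: algebra_simps)
  with w show "p t = y 0 * p1 t + p 0 * p2 t" by simp
qed

text \<open>With equal masses the coefficient is the same in both directions and commutes with
  rotations. Passing to a frame rotated by the angle \<open>t\<close> therefore only removes the
  coupling.\<close>

lemma hill_of_solves:
  assumes x: "solves (kepler_coeff e 0) (kepler_coeff e 0) x"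
  shows "hill e (\<lambda>t. x 2 t * cos t - x 3 t * sin t) (\<lambda>t. x 0 t * cos t - x 1 t * sin t)"
    and "hill e (\<lambda>t. x 2 t * sin t + x 3 t * cos t) (\<lambda>t. x 0 t * sin t + x 1 t * cos t)"
proof -
  {
    fix t assume t: "t \<in> {0..2 * pi}"
    have "((\<lambda>t. x 2 t * cos t - x 3 t * sin t) has_real_derivative x 0 t * cos t - x 1 t * sin t)
        (at t within {0..2 * pi})"
      "((\<lambda>t. x 0 t * cos t - x 1 t * sin t) has_real_derivative
        - kepler_coeff e 0 t * (x 2 t * cos t - x 3 t * sin t)) (at t within {0..2 * pi})"
      "((\<lambda>t. x 2 t * sin t + x 3 t * cos t) has_real_derivative x 0 t * sin t + x 1 t * cos t)
        (at t within {0..2 * pi})"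
      "((\<lambda>t. x 0 t * sin t + x 1 t * cos t) has_real_derivative
        - kepler_coeff e 0 t * (x 2 t * sin t + x 3 t * cos t)) (at t within {0..2 * pi})"
      by ((rule derivative_eq_intros solvesD[OF x t] refl)+, simp add: algebra_simps)+
  }
  then show "hill e (\<lambda>t. x 2 t * cos t - x 3 t * sin t) (\<lambda>t. x 0 t * cos t - x 1 t * sin t)"
    and "hill e (\<lambda>t. x 2 t * sin t + x 3 t * cos t) (\<lambda>t. x 0 t * sin t + x 1 t * cos t)"
    by (simp_all add: hill_def)
qed

section \<open>Growth over one period for Hill's equation\<close>

text \<open>The claims follow from \<open>cooperative_growth\<close> with \<open>v\<close> and
  \<open>w\<close> in the two possible roles. Since \<open>u\<close> is periodic and
  \<open>sin\<close> vanishes at both ends, growth of \<open>v\<close> or \<open>w\<close> carries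
  over to \<open>y\<close> or \<open>p\<close>.\<close>

lemma hill_growth:
  assumes e: "e \<in> {0..<1}" and y: "hill e y p"
  shows "y 0 = 1 \<Longrightarrow> p 0 = 0 \<Longrightarrow> y (2 * pi) > 1"
    and "y 0 = 0 \<Longrightarrow> p 0 = 1 \<Longrightarrow> p (2 * pi) > 1"
proof -
  define u where "u = (\<lambda>t. 1 + e * cos t)"
  define v where "v = (\<lambda>t. y t / u t)"
  define w where "w = (\<lambda>t. u t * p t + e * sin t * y t)"
  have u: "u t > 0" for t using kepler_denom_pos[OF e] by (simp add: u_def)
  have u': "(u has_real_derivative - (e * sin t)) (at t within S)" for t S
    unfolding u_def by (auto intro!: derivative_eq_intros)
  have v': "(v has_real_derivative 1 / (u t)\<^sup>2 * w t) (at t within {0..2 * pi})"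
    if t: "t \<in> {0..2 * pi}" for t
    unfolding v_def w_def using u[of t]
    by - ((rule derivative_eq_intros u' hillD[OF y t] refl)+,
        simp_all add: power2_eq_square field_simps)
  have w': "(w has_real_derivative u t / 2 * v t) (at t within {0..2 * pi})"
    if t: "t \<in> {0..2 * pi}" for t
  proof -
    have k: "kepler_coeff e 0 t = 1 - 3 / (2 * u t)"
      using u[of t] by (simp add: kepler_coeff_def u_def field_simps)
    have "(w has_real_derivative - (e * sin t) * p t + u t * (- kepler_coeff e 0 t * y t)
        + (e * cos t * y t + e * sin t * p t)) (at t within {0..2 * pi})"
      unfolding w_def by (rule derivative_eq_intros u' hillD[OF y t] refl)+ simp
    also have "- (e * sin t) * p t + u t * (- kepler_coeff e 0 t * y t)
        + (e * cos t * y t + e * sin t * p t) = (- u t * kepler_coeff e 0 t + e * cos t) * y t"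
      by (simp add: algebra_simps)
    \<comment> \<open>The factor of \<open>y t\<close> is \<open>3 / 2 - u t\<close> from the
      coefficient plus \<open>u t - 1\<close> from \<open>e * cos t\<close>, hence
      \<open>1 / 2\<close>.\<close>
    also have "\<dots> = u t / 2 * v t"
      using u[of t] unfolding k v_def by (simp add: u_def field_simps)
    finally show ?thesis .
  qed
  have u_end: "u (2 * pi) = u 0" by (simp add: u_def)
  {
    assume init: "y 0 = 1" "p 0 = 0"
    have "v 0 < v (2 * pi)"
      by (rule cooperative_growth[OF _ v' w'])
        (use u init in \<open>simp_all add: v_def w_def less_imp_neq[symmetric]\<close>)
    then show "y (2 * pi) > 1"
      using u[of 0] init by (simp add: v_def u_end divide_less_cancel)
  next
    assume init: "y 0 = 0" "p 0 = 1"
    have "w 0 < w (2 * pi)"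
      by (rule cooperative_growth[OF _ w' v'])
        (use u init in \<open>simp_all add: v_def w_def less_imp_neq[symmetric]\<close>)
    then show "p (2 * pi) > 1"
      using u[of 0] init by (simp add: w_def u_end)
  }
qed

section \<open>Monodromy matrix and double eigenvalues for equal masses\<close>

text \<open>Both rotated components obey the same Hill equation, and rotation by a full turn is the
  identity. So a single 2 by 2 monodromy matrix acts on each pair of a momentum and its position,
  with a Wronskian as determinant.\<close>

lemma equal_mass_monodromy:
  assumes e: "e \<in> {0..<1}" and g: "fundamental_solution 9 e g"
  obtains a b c d where "a > 1" "d > 1" "a * d - b * c = 1"
    "g (2 * pi) = four_block_mat (a \<cdot>\<^sub>m 1\<^sub>m 2) (b \<cdot>\<^sub>m 1\<^sub>m 2) (c \<cdot>\<^sub>m 1\<^sub>m 2) (d \<cdot>\<^sub>m 1\<^sub>m 2)"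
proof -
  have M: "g (2 * pi) \<in> carrier_mat 4 4" and g0: "g 0 = 1\<^sub>m 4"
    using g by (auto simp: fundamental_solution_def)
  have sol: "solves (kepler_coeff e 0) (kepler_coeff e 0) (\<lambda>i t. g t $$ (i, j))" if "j < 4" for j
    using solves_column[OF g that] by simp
  \<comment> \<open>Columns 2 and 0 start at the unit vectors of the first position and the first
    momentum, so their first rotated components are the two basic solutions.\<close>
  define y1 where "y1 = (\<lambda>t. g t $$ (2, 2) * cos t - g t $$ (3, 2) * sin t)"
  define p1 where "p1 = (\<lambda>t. g t $$ (0, 2) * cos t - g t $$ (1, 2) * sin t)"
  define y2 where "y2 = (\<lambda>t. g t $$ (2, 0) * cos t - g t $$ (3, 0) * sin t)"
  define p2 where "p2 = (\<lambda>t. g t $$ (0, 0) * cos t - g t $$ (1, 0) * sin t)"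
  have 1: "hill e y1 p1" "y1 0 = 1" "p1 0 = 0"
    using hill_of_solves(1)[OF sol[of 2]] by (simp_all add: y1_def p1_def g0)
  have 2: "hill e y2 p2" "y2 0 = 0" "p2 0 = 1"
    using hill_of_solves(1)[OF sol[of 0]] by (simp_all add: y2_def p2_def g0)
  have T: "2 * pi \<in> {0..2 * pi}" by simp
  have cols: "g (2 * pi) $$ (2, j) = g 0 $$ (2, j) * y1 (2 * pi) + g 0 $$ (0, j) * y2 (2 * pi)"
    "g (2 * pi) $$ (0, j) = g 0 $$ (2, j) * p1 (2 * pi) + g 0 $$ (0, j) * p2 (2 * pi)"
    "g (2 * pi) $$ (3, j) = g 0 $$ (3, j) * y1 (2 * pi) + g 0 $$ (1, j) * y2 (2 * pi)"
    "g (2 * pi) $$ (1, j) = g 0 $$ (3, j) * p1 (2 * pi) + g 0 $$ (1, j) * p2 (2 * pi)"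
    if "j < 4" for j
    using hill_combination[OF hill_of_solves(1)[OF sol[OF that]] 1 2 T]
      hill_combination[OF hill_of_solves(2)[OF sol[OF that]] 1 2 T] by simp_all
  show thesis
  proof
    show "p2 (2 * pi) > 1" "y1 (2 * pi) > 1"
      using hill_growth(2)[OF e 2(1)] hill_growth(1)[OF e 1(1)] 1 2 by auto
    show "p2 (2 * pi) * y1 (2 * pi) - p1 (2 * pi) * y2 (2 * pi) = 1"
      using hill_wronskian[OF 1(1) 2(1) T] 1 2 by (simp add: mult.commute)
    show "g (2 * pi) = four_block_mat (p2 (2 * pi) \<cdot>\<^sub>m 1\<^sub>m 2) (p1 (2 * pi) \<cdot>\<^sub>m 1\<^sub>m 2)
        (y2 (2 * pi) \<cdot>\<^sub>m 1\<^sub>m 2) (y1 (2 * pi) \<cdot>\<^sub>m 1\<^sub>m 2)" (is "_ = ?F")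
    proof (rule eq_matI)
      fix i j assume "i < dim_row ?F" "j < dim_col ?F"
      then have ij: "i < 4" "j < 4" by auto
      then have "i = 0 \<or> i = 1 \<or> i = 2 \<or> i = 3" "j = 0 \<or> j = 1 \<or> j = 2 \<or> j = 3" by auto
      then show "g (2 * pi) $$ (i, j) = ?F $$ (i, j)"
        by (elim disjE) (simp_all add: cols g0 del: One_nat_def)
    qed (use M in auto)
  qed
qed

text \<open>Scalar blocks commute, so the determinant of the block matrix is that of
  \<open>?A * ?D - ?B * ?C\<close>, which is again scalar.\<close>

lemma char_poly_scalar_blocks:
  fixes a b c d :: "'a :: field"
  shows "char_poly (four_block_mat (a \<cdot>\<^sub>m 1\<^sub>m n) (b \<cdot>\<^sub>m 1\<^sub>m n) (c \<cdot>\<^sub>m 1\<^sub>m n) (d \<cdot>\<^sub>m 1\<^sub>m n)) =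
    [:a * d - b * c, - (a + d), 1:] ^ n"
proof -
  let ?A = "[:- a, 1:] \<cdot>\<^sub>m (1\<^sub>m n :: 'a poly mat)" and ?B = "[:- b:] \<cdot>\<^sub>m (1\<^sub>m n :: 'a poly mat)"
  let ?C = "[:- c:] \<cdot>\<^sub>m (1\<^sub>m n :: 'a poly mat)" and ?D = "[:- d, 1:] \<cdot>\<^sub>m (1\<^sub>m n :: 'a poly mat)"
  have "char_poly_matrix (four_block_mat (a \<cdot>\<^sub>m 1\<^sub>m n) (b \<cdot>\<^sub>m 1\<^sub>m n) (c \<cdot>\<^sub>m 1\<^sub>m n) (d \<cdot>\<^sub>m 1\<^sub>m n))
      = four_block_mat ?A ?B ?C ?D"
    by (rule eq_matI) (auto simp: char_poly_matrix_def)
  moreover have "det (four_block_mat ?A ?B ?C ?D) = det (?A * ?D - ?B * ?C)"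
    by (rule det_four_block_mat) (auto simp: mult.commute)
  moreover have "?A * ?D - ?B * ?C = [:a * d - b * c, - (a + d), 1:] \<cdot>\<^sub>m 1\<^sub>m n"
    by (rule eq_matI) (auto simp: algebra_simps)
  ultimately show ?thesis
    by (simp add: char_poly_def)
qed

text \<open>The characteristic polynomial is the square of \<open>X^2 - (a + d) X + 1\<close>. As
  \<open>a + d\<close> exceeds 2, this quadratic has two distinct positive roots with product
  1.\<close>

lemma equal_mass_double_eigenvalues:
  assumes e: "e \<in> {0..<1}" and g: "fundamental_solution 9 e g"
  shows "\<exists>\<mu>>0. inverse \<mu> \<noteq> 1 \<and> double_eigenvalue (g (2 * pi)) \<mu> \<and>
    double_eigenvalue (g (2 * pi)) (inverse \<mu>)"
proof -
  obtain a b c d where ad: "a > 1" "d > 1" and det: "a * d - b * c = 1"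
    and M: "g (2 * pi) =
      four_block_mat (a \<cdot>\<^sub>m 1\<^sub>m 2) (b \<cdot>\<^sub>m 1\<^sub>m 2) (c \<cdot>\<^sub>m 1\<^sub>m 2) (d \<cdot>\<^sub>m 1\<^sub>m 2)"
    using equal_mass_monodromy[OF e g] .
  have carrier: "g (2 * pi) \<in> carrier_mat 4 4" unfolding M by auto
  \<comment> \<open>The root of the discriminant of that quadratic; \<open>\<mu>\<close> is its
    larger zero.\<close>
  define s where "s = sqrt ((a + d)\<^sup>2 - 4)"
  have "(a + d)\<^sup>2 > 2\<^sup>2"
    using ad by (intro power_strict_mono) auto
  then have s: "s > 0" "s\<^sup>2 = (a + d)\<^sup>2 - 4" by (auto simp: s_def)
  define \<mu> where "\<mu> = (a + d + s) / 2"
  have \<mu>: "\<mu> > 1" using ad s by (simp add: \<mu>_def)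
  have "\<mu> * (a + d - \<mu>) = 1"
    using s(2) unfolding \<mu>_def by (simp add: field_simps power2_eq_square)
  then have inv: "inverse \<mu> = a + d - \<mu>"
    by (rule inverse_unique)
  have fac: "char_poly (g (2 * pi)) = [:- \<mu>, 1:] ^ 2 * [:- inverse \<mu>, 1:] ^ 2"
  proof -
    have "[:- \<mu>, 1:] * [:- inverse \<mu>, 1:] = [:1, - (a + d), 1:]"
      using \<mu> by (simp add: inv[symmetric]) (simp add: inv)
    then show ?thesis
      unfolding M char_poly_scalar_blocks det by (metis power_mult_distrib)
  qed
  have ne: "inverse \<mu> \<noteq> \<mu>" "inverse \<mu> \<noteq> 1"
    using \<mu> inverse_less_1_iff[of \<mu>] by auto
  \<comment> \<open>The two squared factors have different roots, so only one of them contributes to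
    the order at each root.\<close>
  have "Polynomial.order \<mu> (char_poly (g (2 * pi))) = 2"
    unfolding fac using ne
    by (subst order_mult) (auto simp: order_power_n_n intro!: order_0I)
  moreover have "Polynomial.order (inverse \<mu>) (char_poly (g (2 * pi))) = 2"
    unfolding fac using ne
    by (subst order_mult) (auto simp: order_power_n_n intro!: order_0I)
  moreover have "eigenvalue (g (2 * pi)) \<mu>" "eigenvalue (g (2 * pi)) (inverse \<mu>)"
    unfolding eigenvalue_root_char_poly[OF carrier] fac by simp_all
  ultimately show ?thesis
    using \<mu> ne by (auto simp: double_eigenvalue_def intro!: exI[of _ \<mu>])
qed

theorem proposition1p4:
  fixes \<gamma> :: "real \<Rightarrow> real \<Rightarrow> real \<Rightarrow> real mat"
  assumes "\<And>\<beta> e. \<beta> \<in> {0..9} \<Longrightarrow> e \<in> {0..<1} \<Longrightarrow> fundamental_solution \<beta> e (\<gamma> \<beta> e)"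
  shows "(\<forall>e\<in>{0..<1}. hyperbolic (\<gamma> 9 e (2 * pi)) \<and>
            (\<exists>\<mu>>0. inverse \<mu> \<noteq> 1 \<and>
               double_eigenvalue (\<gamma> 9 e (2 * pi)) \<mu> \<and>
               double_eigenvalue (\<gamma> 9 e (2 * pi)) (inverse \<mu>))) \<and>
         (\<forall>e\<in>{0..<1}. \<exists>\<delta>>0. \<forall>\<beta>\<in>{0..<9}. 9 - \<delta> < \<beta> \<longrightarrow> hyperbolic (\<gamma> \<beta> e (2 * pi)))"
proof (intro conjI ballI)
  fix e :: real assume e: "e \<in> {0..<1}"
  show "hyperbolic (\<gamma> 9 e (2 * pi))"
    using assms e by (intro hyperbolic_near_equal_mass[OF e, of 9]) auto
  show "\<exists>\<mu>>0. inverse \<mu> \<noteq> 1 \<and> double_eigenvalue (\<gamma> 9 e (2 * pi)) \<mu> \<and>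
      double_eigenvalue (\<gamma> 9 e (2 * pi)) (inverse \<mu>)"
    using assms e by (intro equal_mass_double_eigenvalues) auto
  \<comment> \<open>The witness \<open>\<delta> = 1\<close> reflects the range
    \<open>8 < \<beta>\<close> of the monotonicity argument.\<close>
  have "hyperbolic (\<gamma> \<beta> e (2 * pi))" if "\<beta> \<in> {0..<9}" "9 - 1 < \<beta>" for \<beta>
    using assms e that by (intro hyperbolic_near_equal_mass[OF e, of \<beta>]) auto
  then show "\<exists>\<delta>>0. \<forall>\<beta>\<in>{0..<9}. 9 - \<delta> < \<beta> \<longrightarrow> hyperbolic (\<gamma> \<beta> e (2 * pi))"
    by (intro exI[of _ 1]) auto
qed

end
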